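(* Let $\mathfrak{g}=\mathfrak{g}_{3.2}\oplus\mathfrak{g}_1$ be the four-dimensional real Lie algebra with basis $\mathcal{B}=\{e_1,e_2,e_3,e_4\}$ whose nonzero Lie brackets (up to skew-symmetry) are $[e_2,e_3]=e_1-e_2$, $[e_3,e_1]=e_1$. Let $\langle\cdot,\cdot\rangle$ be a pseudo-Riemannian inner product on $\mathfrak{g}$ and let $(R_{ij})$ be the matrix of its Ricci operator $\operatorname{Ric}$ in the basis $\mathcal{B}$. Then $\langle\cdot,\cdot\rangle$ is an algebraic Ricci soliton if and only if $$R_{i1}=0\ (i=2,3,4),\quad R_{32}=R_{42}=0,\quad R_{i4}=0\ (i=1,2,3),\quad R_{22}=R_{11}.$$ Provided these conditions are satisfied, $\operatorname{Ric}=\eta I_4+D$ where $\eta=R_{33}$ and $$D=\begin{bmatrix}R_{11}-R_{33}&R_{12}&R_{13}&0\\0&R_{11}-R_{33}&R_{23}&0\\0&0&0&0\\0&0&R_{43}&R_{44}-R_{33}\end{bmatrix}$$ is (the matrix in the basis $\mathcal{B}$ of) a derivation of $\mathfrak{g}$.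
   Context: A pseudo-Riemannian inner product on a real Lie algebra $\mathfrak{g}$ is a nondegenerate symmetric bilinear form $\langle\cdot,\cdot\rangle$ on $\mathfrak{g}$ (of some signature $(r,s)$). Its Levi-Civita connection $\nabla$ is defined by $2\langle\nabla_uv,w\rangle=\langle[u,v],w\rangle+\langle[w,u],v\rangle+\langle[w,v],u\rangle$; its curvature is $R_{uv}=\nabla_{[u,v]}-[\nabla_u,\nabla_v]$; its Ricci curvature $\operatorname{ric}(u,v)$ is the trace of $w\mapsto R_{uw}v$; its Ricci operator $\operatorname{Ric}$ is the endomorphism of $\mathfrak{g}$ with $\langle\operatorname{Ric}(u),v\rangle=\operatorname{ric}(u,v)$. The matrix $(R_{ij})$ of $\operatorname{Ric}$ in a basis $\{e_i\}$ is given by $\operatorname{Ric}(e_j)=\sum_iR_{ij}e_i$ (the same column convention is used for $D$). A derivation is a linear map $D:\mathfrak{g}\to\mathfrak{g}$ with $D[x,y]=[D(x),y]+[x,D(y)]$ for all $x,y$. The inner product is an algebraic Ricci soliton if $\operatorname{Ric}=\eta\,\mathrm{Id}_{\mathfrak{g}}+D$ for some $\eta\in\mathbb{R}$ and some derivation $D$ of $\mathfrak{g}$. *)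

theory Defs
  imports "HOL-Analysis.Analysis"
begin

definition lie_bracket :: "(real^'n \<Rightarrow> real^'n \<Rightarrow> real^'n) \<Rightarrow> bool" where
  "lie_bracket br \<longleftrightarrow> bilinear br \<and> (\<forall>x. br x x = 0) \<and>
     (\<forall>x y z. br x (br y z) + br y (br z x) + br z (br x y) = 0)"

definition derivation ::
    "(real^'n \<Rightarrow> real^'n \<Rightarrow> real^'n) \<Rightarrow> (real^'n \<Rightarrow> real^'n) \<Rightarrow> bool" where
  "derivation br D \<longleftrightarrow> linear D \<and> (\<forall>x y. D (br x y) = br (D x) y + br x (D y))"

definition pseudo_riemannian :: "(real^'n \<Rightarrow> real^'n \<Rightarrow> real) \<Rightarrow> bool" where
  "pseudo_riemannian g \<longleftrightarrow> bilinear g \<and> (\<forall>x y. g x y = g y x) \<and>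
     (\<forall>x. (\<forall>y. g x y = 0) \<longrightarrow> x = 0)"

text \<open>The definite descriptions below are justified by the Riesz representation lemma
  \<open>pseudo_riemannian_riesz\<close>; see \<open>levi_civita_koszul\<close> and \<open>ricci_operator_ricci\<close>.\<close>

definition levi_civita ::
    "(real^'n \<Rightarrow> real^'n \<Rightarrow> real^'n) \<Rightarrow> (real^'n \<Rightarrow> real^'n \<Rightarrow> real)
      \<Rightarrow> real^'n \<Rightarrow> real^'n \<Rightarrow> real^'n" where
  "levi_civita br g u v =
     (THE z. \<forall>w. 2 * g z w = g (br u v) w + g (br w u) v + g (br w v) u)"

text \<open>Sign convention: \<open>R\<^sub>u\<^sub>v = \<nabla>\<^bsub>[u,v]\<^esub> - [\<nabla>\<^sub>u, \<nabla>\<^sub>v]\<close>, applied to the third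
  argument.\<close>

definition curvature ::
    "(real^'n \<Rightarrow> real^'n \<Rightarrow> real^'n) \<Rightarrow> (real^'n \<Rightarrow> real^'n \<Rightarrow> real)
      \<Rightarrow> real^'n \<Rightarrow> real^'n \<Rightarrow> real^'n \<Rightarrow> real^'n" where
  "curvature br g u v w = levi_civita br g (br u v) w -
     (levi_civita br g u (levi_civita br g v w) - levi_civita br g v (levi_civita br g u w))"

definition ricci ::
    "(real^'n \<Rightarrow> real^'n \<Rightarrow> real^'n) \<Rightarrow> (real^'n \<Rightarrow> real^'n \<Rightarrow> real)
      \<Rightarrow> real^'n \<Rightarrow> real^'n \<Rightarrow> real" where
  "ricci br g u v = trace (matrix (\<lambda>w. curvature br g u w v))"

definition ricci_operator ::
    "(real^'n \<Rightarrow> real^'n \<Rightarrow> real^'n) \<Rightarrow> (real^'n \<Rightarrow> real^'n \<Rightarrow> real)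
      \<Rightarrow> real^'n \<Rightarrow> real^'n" where
  "ricci_operator br g u = (THE z. \<forall>v. g z v = ricci br g u v)"

definition algebraic_ricci_soliton ::
    "(real^'n \<Rightarrow> real^'n \<Rightarrow> real^'n) \<Rightarrow> (real^'n \<Rightarrow> real^'n \<Rightarrow> real) \<Rightarrow> bool" where
  "algebraic_ricci_soliton br g \<longleftrightarrow>
     (\<exists>\<eta> D. derivation br D \<and> ricci_operator br g = (\<lambda>u. \<eta> *\<^sub>R u + D u))"

text \<open>The Lie algebra \<open>g\<^sub>3\<^sub>.\<^sub>2 \<oplus> g\<^sub>1\<close>. The basis \<open>e\<^sub>1, \<dots>, e\<^sub>4\<close> is the standard basis \<open>axis i 1\<close>, so that \<open>matrix f\<close> is the
  matrix of \<open>f\<close> in this basis, with the images of the basis vectors as columns. (In the index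
  type \<open>4\<close> the numeral \<open>4\<close> denotes the same element as \<open>0\<close>; the numerals \<open>1, 2, 3, 4\<close> are its four
  distinct elements.) The definition is the bilinear alternating extension of the bracket
  relations in \<open>g32_g1_bracket_basis\<close>.\<close>

definition g32_g1_bracket :: "real^4 \<Rightarrow> real^4 \<Rightarrow> real^4" where
  "g32_g1_bracket x y =
     (x $ 2 * y $ 3 - x $ 3 * y $ 2) *\<^sub>R (axis 1 1 - axis 2 1) +
     (x $ 3 * y $ 1 - x $ 1 * y $ 3) *\<^sub>R axis 1 1"

lemma g32_g1_bracket_basis:
  "g32_g1_bracket (axis 2 1) (axis 3 1) = axis 1 1 - axis 2 1"
  "g32_g1_bracket (axis 3 1) (axis 1 1) = axis 1 1"
  "g32_g1_bracket (axis 1 1) (axis 2 1) = 0"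
  "g32_g1_bracket (axis i 1) (axis 4 1) = 0"
  by (simp_all add: g32_g1_bracket_def axis_def)

lemma lie_bracket_g32_g1: "lie_bracket g32_g1_bracket"
proof -
  have "bilinear g32_g1_bracket"
    unfolding bilinear_def
    by (intro conjI allI linearI)
       (simp_all add: g32_g1_bracket_def vec_eq_iff axis_def algebra_simps)
  moreover have "g32_g1_bracket x (g32_g1_bracket y z) + g32_g1_bracket y (g32_g1_bracket z x) +
      g32_g1_bracket z (g32_g1_bracket x y) = 0" for x y z
    by (simp add: g32_g1_bracket_def vec_eq_iff forall_4 axis_def algebra_simps)
  ultimately show ?thesis
    by (simp add: lie_bracket_def g32_g1_bracket_def)
qed

lemma pseudo_riemannian_riesz:
  fixes g :: "real^'n \<Rightarrow> real^'n \<Rightarrow> real" and f :: "real^'n \<Rightarrow> real"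
  assumes g: "pseudo_riemannian g" and f: "linear f"
  shows "\<exists>!z. \<forall>w. g z w = f w"
proof -
  have bl: "bilinear g" and nd: "\<And>x. (\<And>y. g x y = 0) \<Longrightarrow> x = 0"
    using g by (auto simp: pseudo_riemannian_def)
  have lin1: "linear (\<lambda>x. g x y)" and lin2: "linear (g x)" for x y
    using bl by (auto simp: bilinear_def)
  have expand: "h w = (\<Sum>i\<in>UNIV. h (axis i 1) * w $ i)"
    if "linear h" for h :: "real^'n \<Rightarrow> real" and w
  proof -
    have "h w = h (\<Sum>i\<in>UNIV. (w $ i) *\<^sub>R axis i 1)"
      by (simp add: basis_expansion flip: scalar_mult_eq_scaleR)
    also have "\<dots> = (\<Sum>i\<in>UNIV. h (axis i 1) * w $ i)"
      by (simp add: linear_sum[OF that] linear_scale[OF that] mult.commute)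
    finally show ?thesis .
  qed
  define T :: "real^'n \<Rightarrow> real^'n" where "T z = (\<chi> i. g z (axis i 1))" for z
  have T: "linear T"
    by (rule linearI)
       (simp_all add: T_def vec_eq_iff linear_add[OF lin1] linear_scale[OF lin1])
  have eqI: "z = z'" if "\<And>w. g z w = g z' w" for z z'
  proof -
    have "g (z - z') w = 0" for w
      using that[of w] by (simp add: linear_diff[OF lin1])
    from nd[OF this] show ?thesis by simp
  qed
  have "inj T"
  proof (rule injI)
    fix z z' assume "T z = T z'"
    then have "g z (axis i 1) = g z' (axis i 1)" for i
      by (simp add: T_def vec_eq_iff)
    then have "g z w = g z' w" for w
      by (simp add: expand[OF lin2[of z], of w] expand[OF lin2[of z'], of w])
    then show "z = z'"
      by (rule eqI)
  qed
  then have "surj T"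
    using T linear_injective_imp_surjective by blast
  then obtain z where z: "T z = (\<chi> i. f (axis i 1))"
    by (metis surjD)
  have "g z w = f w" for w
    using z by (simp add: expand[OF lin2[of z], of w] expand[OF f, of w] T_def vec_eq_iff)
  moreover have "z' = z" if "\<forall>w. g z' w = f w" for z'
    using that calculation by (intro eqI) simp
  ultimately show ?thesis
    by blast
qed

lemma linear_koszul:
  assumes "lie_bracket br" and "pseudo_riemannian g"
  shows "linear (\<lambda>w. (g (br u v) w + g (br w u) v + g (br w v) u) / 2)"
  using assms unfolding lie_bracket_def pseudo_riemannian_def
  by (intro linearI)
     (simp_all add: bilinear_ladd bilinear_radd bilinear_lmul bilinear_rmul algebra_simps
        add_divide_distrib)

lemma levi_civita_koszul:
  assumes "lie_bracket br" and "pseudo_riemannian g"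
  shows "2 * g (levi_civita br g u v) w = g (br u v) w + g (br w u) v + g (br w v) u"
proof -
  have "\<exists>!z. \<forall>w. g z w = (g (br u v) w + g (br w u) v + g (br w v) u) / 2"
    by (rule pseudo_riemannian_riesz[OF assms(2) linear_koszul[OF assms]])
  moreover have "(g z w = (g (br u v) w + g (br w u) v + g (br w v) u) / 2) \<longleftrightarrow>
      2 * g z w = g (br u v) w + g (br w u) v + g (br w v) u" for z w
    by auto
  ultimately have "\<exists>!z. \<forall>w. 2 * g z w = g (br u v) w + g (br w u) v + g (br w v) u"
    by simp
  from theI'[OF this] show ?thesis
    by (simp add: levi_civita_def)
qed

lemma bilinear_levi_civita:
  assumes "lie_bracket br" and g: "pseudo_riemannian g"
  shows "bilinear (levi_civita br g)"
proof -
  have br: "bilinear br" and bg: "bilinear g"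
    using assms by (auto simp: lie_bracket_def pseudo_riemannian_def)
  have nd: "x = y" if "\<And>w. 2 * g x w = 2 * g y w" for x y
  proof -
    have "\<forall>w. g (x - y) w = 0"
      using that by (simp add: bilinear_lsub[OF bg])
    then have "x - y = 0"
      using g unfolding pseudo_riemannian_def by blast
    then show ?thesis by simp
  qed
  note K = levi_civita_koszul[OF assms]
  note simps = bilinear_ladd[OF br] bilinear_radd[OF br] bilinear_lmul[OF br] bilinear_rmul[OF br]
    bilinear_ladd[OF bg] bilinear_radd[OF bg] bilinear_lmul[OF bg] bilinear_rmul[OF bg]
  have "levi_civita br g (x + y) z = levi_civita br g x z + levi_civita br g y z" for x y z
    by (rule nd) (simp only: bilinear_ladd[OF bg] distrib_left K, simp add: simps algebra_simps)
  moreover have "levi_civita br g z (x + y) = levi_civita br g z x + levi_civita br g z y" for x y z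
    by (rule nd) (simp only: bilinear_ladd[OF bg] distrib_left K, simp add: simps algebra_simps)
  moreover have "levi_civita br g (c *\<^sub>R x) z = c *\<^sub>R levi_civita br g x z" for c x z
    by (rule nd)
       (simp only: bilinear_lmul[OF bg] mult.left_commute[of 2 c] real_scaleR_def K,
        simp add: simps algebra_simps)
  moreover have "levi_civita br g z (c *\<^sub>R x) = c *\<^sub>R levi_civita br g z x" for c x z
    by (rule nd)
       (simp only: bilinear_lmul[OF bg] mult.left_commute[of 2 c] real_scaleR_def K,
        simp add: simps algebra_simps)
  ultimately show ?thesis
    unfolding bilinear_def by (intro conjI allI linearI) auto
qed

lemma bilinear_ricci:
  assumes "lie_bracket br" and "pseudo_riemannian g"
  shows "bilinear (ricci br g)"
proof -
  have br: "bilinear br"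
    using assms by (auto simp: lie_bracket_def)
  note n = bilinear_levi_civita[OF assms]
  show ?thesis
    unfolding bilinear_def
    by (intro conjI allI linearI)
       (simp_all add: ricci_def curvature_def trace_def matrix_def sum.distrib sum_distrib_left
          bilinear_ladd[OF br] bilinear_radd[OF br] bilinear_lmul[OF br] bilinear_rmul[OF br]
          bilinear_ladd[OF n] bilinear_radd[OF n] bilinear_lmul[OF n] bilinear_rmul[OF n]
          sum_subtractf algebra_simps)
qed

lemma ricci_operator_ricci:
  assumes "lie_bracket br" and "pseudo_riemannian g"
  shows "g (ricci_operator br g u) v = ricci br g u v"
proof -
  have "linear (ricci br g u)"
    using bilinear_ricci[OF assms] by (simp add: bilinear_def)
  from theI'[OF pseudo_riemannian_riesz[OF assms(2) this]] show ?thesis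
    by (simp add: ricci_operator_def)
qed

end

theory Submission
  imports Defs
begin

text \<open>No curvature computation is needed: only linearity of the Ricci operator enters. A derivation
  preserves \<open>[g,g] = span {e\<^sub>1, e\<^sub>2}\<close> and the center \<open>span {e\<^sub>4}\<close>. Since \<open>ad e\<^sub>3\<close> is a Jordan
  block with eigenvalue \<open>1\<close> on \<open>[g,g]\<close>, it satisfies \<open>D\<^sub>3\<^sub>3 = 0\<close> and commutes with that block, so
  \<open>D\<^sub>2\<^sub>1 = 0\<close> and \<open>D\<^sub>2\<^sub>2 = D\<^sub>1\<^sub>1\<close>. The vanishing of \<open>D\<^sub>3\<^sub>3\<close> forces \<open>\<eta> = R\<^sub>3\<^sub>3\<close>.\<close>

lemma vector_4:
  fixes w x y z :: "'a::zero"
  shows "(vector [w, x, y, z] :: 'a^4) $ 1 = w"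
    and "(vector [w, x, y, z] :: 'a^4) $ 2 = x"
    and "(vector [w, x, y, z] :: 'a^4) $ 3 = y"
    and "(vector [w, x, y, z] :: 'a^4) $ 4 = z"
  unfolding vector_def by simp_all

text \<open>Nondegeneracy transfers linearity from \<open>ricci\<close>: the two sides of each
  linearity identity pair equally with every vector under \<open>g\<close>, so they
  coincide.\<close>

lemma linear_ricci_operator:
  assumes br: "lie_bracket br" and g: "pseudo_riemannian g"
  shows "linear (ricci_operator br g)"
proof -
  have bg: "bilinear g"
    using g by (simp add: pseudo_riemannian_def)
  note ricci = bilinear_ricci[OF br g] and G = ricci_operator_ricci[OF br g]
  have nd: "x = y" if "\<And>w. g x w = g y w" for x y
  proof -
    have "\<forall>w. g (x - y) w = 0"
      using that by (simp add: bilinear_lsub[OF bg])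
    then have "x - y = 0"
      using g unfolding pseudo_riemannian_def by blast
    then show ?thesis by simp
  qed
  show ?thesis
    by (intro linearI nd)
       (simp_all add: G bilinear_ladd[OF bg] bilinear_lmul[OF bg] bilinear_ladd[OF ricci]
          bilinear_lmul[OF ricci])
qed

text \<open>The soliton conditions are read off from one direction; the other certifies the explicit
  matrix \<open>D\<close>.\<close>

lemma derivation_g32_g1_iff:
  fixes A :: "real^4^4"
  shows "derivation g32_g1_bracket ((*v) A) \<longleftrightarrow>
    A $ 2 $ 1 = 0 \<and> A $ 3 $ 1 = 0 \<and> A $ 4 $ 1 = 0 \<and>
    A $ 2 $ 2 = A $ 1 $ 1 \<and> A $ 3 $ 2 = 0 \<and> A $ 4 $ 2 = 0 \<and>
    A $ 3 $ 3 = 0 \<and> A $ 1 $ 4 = 0 \<and> A $ 2 $ 4 = 0 \<and> A $ 3 $ 4 = 0"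
    (is "_ \<longleftrightarrow> ?P")
proof
  assume "derivation g32_g1_bracket ((*v) A)"
  then have D: "A *v g32_g1_bracket x y = g32_g1_bracket (A *v x) y + g32_g1_bracket x (A *v y)"
    for x y
    by (simp add: derivation_def)
  note simps = vec_eq_iff forall_4 g32_g1_bracket_def matrix_vector_mult_def sum_4 axis_def
  \<comment> \<open>The pairs (e2,e3) and (e3,e1) give A21 = -A33 and A21 = A33, so both vanish, and
    then A22 = A11 and A41 = A42 = 0. The pair (e1,e2) gives A31 = A32 = 0, and the pairs with e4
    clear column 4 above the diagonal.\<close>
  show ?P
    using D[of "axis 2 1" "axis 3 1"] D[of "axis 3 1" "axis 1 1"] D[of "axis 1 1" "axis 2 1"]
      D[of "axis 3 1" "axis 4 1"] D[of "axis 1 1" "axis 4 1"]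
    by (simp add: simps)
next
  assume ?P
  then show "derivation g32_g1_bracket ((*v) A)"
    by (simp add: derivation_def vec_eq_iff forall_4 g32_g1_bracket_def
        matrix_vector_mult_def sum_4 axis_def algebra_simps)
qed

theorem theorem3p4:
  fixes g :: "real^4 \<Rightarrow> real^4 \<Rightarrow> real" and R :: "real^4^4"
  assumes "pseudo_riemannian g"
    and "R = matrix (ricci_operator g32_g1_bracket g)"
  shows
    "let conditions =
           (\<forall>i\<in>{2,3,4}. R $ i $ 1 = 0) \<and> R $ 3 $ 2 = 0 \<and> R $ 4 $ 2 = 0 \<and>
           (\<forall>i\<in>{1,2,3}. R $ i $ 4 = 0) \<and> R $ 2 $ 2 = R $ 1 $ 1;
         \<eta> = R $ 3 $ 3;
         D = vector
           [vector [R $ 1 $ 1 - R $ 3 $ 3, R $ 1 $ 2, R $ 1 $ 3, 0],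
            vector [0, R $ 1 $ 1 - R $ 3 $ 3, R $ 2 $ 3, 0],
            vector [0, 0, 0, 0],
            vector [0, 0, R $ 4 $ 3, R $ 4 $ 4 - R $ 3 $ 3]] :: real^4^4
     in (algebraic_ricci_soliton g32_g1_bracket g \<longleftrightarrow> conditions) \<and>
        (conditions \<longrightarrow>
           ricci_operator g32_g1_bracket g = (\<lambda>u. \<eta> *\<^sub>R u + D *v u) \<and>
           derivation g32_g1_bracket ((*v) D))"
proof -
  let ?Ric = "ricci_operator g32_g1_bracket g"
  have lin: "linear ?Ric"
    using linear_ricci_operator[OF lie_bracket_g32_g1 assms(1)] .
  have Ric: "?Ric = (*v) R"
    using lin by (simp add: assms(2))
  define cond where "cond \<longleftrightarrow>
    (\<forall>i\<in>{2,3,4}. R $ i $ 1 = 0) \<and> R $ 3 $ 2 = 0 \<and> R $ 4 $ 2 = 0 \<and>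
    (\<forall>i\<in>{1,2,3}. R $ i $ 4 = 0) \<and> R $ 2 $ 2 = R $ 1 $ 1"
  define D :: "real^4^4" where "D = vector
    [vector [R $ 1 $ 1 - R $ 3 $ 3, R $ 1 $ 2, R $ 1 $ 3, 0],
     vector [0, R $ 1 $ 1 - R $ 3 $ 3, R $ 2 $ 3, 0],
     vector [0, 0, 0, 0],
     vector [0, 0, R $ 4 $ 3, R $ 4 $ 4 - R $ 3 $ 3]]"
  \<comment> \<open>\<open>D\<close> has the zero pattern of the criterion by construction;
    \<open>cond\<close> says exactly that R - R33 I equals \<open>D\<close>.\<close>
  have derD: "derivation g32_g1_bracket ((*v) D)"
    by (simp add: derivation_g32_g1_iff D_def vector_4)
  have RicD: "?Ric = (\<lambda>u. R $ 3 $ 3 *\<^sub>R u + D *v u)" if cond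
    using that
    by (simp add: Ric cond_def D_def fun_eq_iff vec_eq_iff forall_4 matrix_vector_mult_def sum_4
        vector_4 algebra_simps)
  have "cond" if "algebraic_ricci_soliton g32_g1_bracket g"
  proof -
    from that obtain \<eta> E where E: "derivation g32_g1_bracket E"
      and RicE: "?Ric = (\<lambda>u. \<eta> *\<^sub>R u + E u)"
      by (auto simp: algebraic_ricci_soliton_def)
    define A where "A = matrix E"
    have EA: "E = (*v) A"
      using E by (simp add: A_def derivation_def)
    \<comment> \<open>Adding \<eta> shifts all diagonal entries equally, so the off-diagonal zeros
      of \<open>A\<close> and A22 = A11 pass to \<open>R\<close>.\<close>
    have "R $ i $ j = (if i = j then \<eta> else 0) + A $ i $ j" for i j
      by (simp add: assms(2) RicE EA matrix_def matrix_vector_mul_component axis_def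
          matrix_vector_mult_def if_distrib cong: if_cong)
    then show cond
      using E unfolding EA derivation_g32_g1_iff by (simp add: cond_def)
  qed
  moreover have "algebraic_ricci_soliton g32_g1_bracket g" if cond
    using derD RicD[OF that] unfolding algebraic_ricci_soliton_def by blast
  ultimately show ?thesis
    using derD RicD unfolding Let_def cond_def[symmetric] D_def[symmetric] by blast
qed

end
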